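(* Let $X$ be a finite set with at least three elements, let $n\ge 2$ be an integer, $N(n)=\{1,\dots,n\}$, and let $\mathcal{L}^{N(n)}$ be the set of all preference profiles (all functions from $N(n)$ to the set $\mathcal{L}$ of strict rankings on $X$). Let $f$ be a choice function on $\mathcal{L}^{N(n)}$. Then $f$ satisfies the Weak Dominance Criterion (WDC) and Global Independence of Irrelevant Alternatives (GIIA) if and only if $f$ is a state-salient decision rule (S-SDR).
   Context: $X$ is the finite set of alternatives, $|X|\ge 3$; $N(n)=\{1,\dots,n\}$, $n\ge2$, is the set of states of nature. A strict ranking on $X$ is a reflexive, complete, transitive and antisymmetric binary relation $R$ on $X$; $xRy$ means $(x,y)\in R$, and for $x\ne y$ it is read "$x$ is strictly preferred to $y$". $\mathcal{L}$ is the set of all strict rankings on $X$. A preference profile is a function $R_{N(n)}=\langle R_i \mid i\in N(n)\rangle$ from $N(n)$ to $\mathcal{L}$; $\mathcal{L}^{N(n)}$ is the set of all preference profiles. $R_i|A$ denotes the restriction of $R_i$ to a subset $A\subset X$. A choice function (CF) on a non-empty set $\mathcal{D}\subset\mathcal{L}^{N(n)}$ is a function $f$ from $\mathcal{D}$ to the set of all non-empty subsets of $X$. WDC: a CF $f$ on $\mathcal{D}$ satisfies the Weak Dominance Criterion if for all $x,y\in X$ with $x\ne y$ and all $R_{N(n)}\in\mathcal{D}$: if $xR_iy$ for all $i\in N(n)$, then $y\notin f(R_{N(n)})$. GIIA: a CF $f$ on $\mathcal{D}$ satisfies Global Independence of Irrelevant Alternatives if for all $R_{N(n)},R'_{N(n)}\in\mathcal{D}$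 and all $x,y\in X$ with $x\neq y$: if $R_i|\{x,y\}=R'_i|\{x,y\}$ for all $i\in N(n)$, $x\in f(R_{N(n)})$ and $y\notin f(R_{N(n)})$, then $y\notin f(R'_{N(n)})$. S-SDR: a CF $f$ on $\mathcal{L}^{N(n)}$ is a state-salient decision rule if there exists $i\in N(n)$ such that for all $x,y\in X$ with $x\ne y$ and all $R_{N(n)}\in\mathcal{L}^{N(n)}$: $xR_iy$ implies $y\notin f(R_{N(n)})$. *)

theory Defs
  imports "HOL-Library.FuncSet"
begin

(* Despite the name, strict rankings are reflexive: for distinct x and y,
   membership of (x, y) in R says that x is strictly preferred to y. *)
definition strict_rankings :: "'a set \<Rightarrow> 'a rel set" where
  "strict_rankings X = {R. linear_order_on X R}"

definition profiles :: "'a set \<Rightarrow> nat \<Rightarrow> (nat \<Rightarrow> 'a rel) set" where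
  "profiles X n = {1..n} \<rightarrow>\<^sub>E strict_rankings X"

(* Only the values of f on the domain D matter, here and in the conditions below. *)
definition choice_function ::
  "'a set \<Rightarrow> nat \<Rightarrow> (nat \<Rightarrow> 'a rel) set \<Rightarrow> ((nat \<Rightarrow> 'a rel) \<Rightarrow> 'a set) \<Rightarrow> bool" where
  "choice_function X n D f \<longleftrightarrow>
     D \<noteq> {} \<and> D \<subseteq> profiles X n \<and> f \<in> D \<rightarrow> {S. S \<subseteq> X \<and> S \<noteq> {}}"

definition WDC ::
  "'a set \<Rightarrow> nat \<Rightarrow> (nat \<Rightarrow> 'a rel) set \<Rightarrow> ((nat \<Rightarrow> 'a rel) \<Rightarrow> 'a set) \<Rightarrow> bool" where
  "WDC X n D f \<longleftrightarrow>
     (\<forall>x\<in>X. \<forall>y\<in>X. \<forall>R\<in>D. x \<noteq> y \<longrightarrow> (\<forall>i\<in>{1..n}. (x, y) \<in> R i) \<longrightarrow> y \<notin> f R)"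

definition GIIA ::
  "'a set \<Rightarrow> nat \<Rightarrow> (nat \<Rightarrow> 'a rel) set \<Rightarrow> ((nat \<Rightarrow> 'a rel) \<Rightarrow> 'a set) \<Rightarrow> bool" where
  "GIIA X n D f \<longleftrightarrow>
     (\<forall>R\<in>D. \<forall>R'\<in>D. \<forall>x\<in>X. \<forall>y\<in>X. x \<noteq> y \<longrightarrow>
        (\<forall>i\<in>{1..n}. Restr (R i) {x, y} = Restr (R' i) {x, y}) \<longrightarrow>
        x \<in> f R \<longrightarrow> y \<notin> f R \<longrightarrow> y \<notin> f R')"

definition state_salient_decision_rule ::
  "'a set \<Rightarrow> nat \<Rightarrow> ((nat \<Rightarrow> 'a rel) \<Rightarrow> 'a set) \<Rightarrow> bool" where
  "state_salient_decision_rule X n f \<longleftrightarrow>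
     (\<exists>i\<in>{1..n}. \<forall>x\<in>X. \<forall>y\<in>X. \<forall>R\<in>profiles X n.
        x \<noteq> y \<longrightarrow> (x, y) \<in> R i \<longrightarrow> y \<notin> f R)"

end

theory Submission
  imports Defs
begin

text \<open>
  Say that \<open>x\<close> beats \<open>y\<close> under a coalition \<open>S\<close> if \<open>y\<close> is never chosen when exactly the states
  in \<open>S\<close> rank \<open>x\<close> above \<open>y\<close>. By GIIA a chosen alternative beats every rejected one, and this
  depends on the coalition only. If three alternatives are on top of every ranking, WDC confines the
  choice to them; this makes \<open>beats\<close> behave like the strict part of a transitive social preference,
  so that the ultrafilter proof of Arrow's theorem applies: the winning coalitions form an
  ultrafilter on the finite set of states, and its principal point is the salient state.
\<close>

section \<open>Strict rankings and their construction from numerical ranks\<close>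

lemma strict_rankingsD:
  assumes "R \<in> strict_rankings X"
  shows "R \<subseteq> X \<times> X" "refl_on X R" "trans R" "antisym R" "total_on X R"
  using assms
  by (auto simp: strict_rankings_def linear_order_on_def partial_order_on_def preorder_on_def)

lemma strict_rankings_not_iff:
  assumes "R \<in> strict_rankings X" "x \<in> X" "y \<in> X" "x \<noteq> y"
  shows "(x, y) \<notin> R \<longleftrightarrow> (y, x) \<in> R"
  using strict_rankingsD[OF assms(1)] assms(2-) by (meson antisymD total_on_def)

text \<open>By reflexivity both diagonal pairs are present, and each off-diagonal pair is present
  exactly when the other is absent, so the restriction carries a single bit.\<close>

lemma Restr_eq_iff:
  assumes "R \<in> strict_rankings X" "R' \<in> strict_rankings X" "x \<in> X" "y \<in> X" "x \<noteq> y"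
  shows "Restr R {x, y} = Restr R' {x, y} \<longleftrightarrow> ((x, y) \<in> R \<longleftrightarrow> (x, y) \<in> R')"
proof -
  have "(x, x) \<in> R" "(x, x) \<in> R'" "(y, y) \<in> R" "(y, y) \<in> R'"
    using strict_rankingsD(2) assms by (metis refl_onD)+
  moreover have "(y, x) \<in> R \<longleftrightarrow> (x, y) \<notin> R" "(y, x) \<in> R' \<longleftrightarrow> (x, y) \<notin> R'"
    using strict_rankings_not_iff assms by metis+
  ultimately show ?thesis by blast
qed

lemma strict_rankings_of_rank:
  fixes h :: "'a \<Rightarrow> nat"
  assumes "inj_on h X"
  shows "{(a, b) \<in> X \<times> X. h a \<le> h b} \<in> strict_rankings X"
  using assms
  by (auto simp: strict_rankings_def linear_order_on_def partial_order_on_def preorder_on_def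
      refl_on_def trans_def antisym_def total_on_def inj_on_def)

text \<open>The two conditions on \<open>p\<close>, \<open>q\<close>, \<open>r\<close> exclude the two cycles on \<open>x\<close>, \<open>y\<close>, \<open>z\<close>.\<close>

lemma ex_strict_ranking_top3:
  assumes "finite X" "x \<in> X" "y \<in> X" "z \<in> X" "x \<noteq> y" "y \<noteq> z" "x \<noteq> z"
    and "p \<and> q \<longrightarrow> r" "r \<longrightarrow> p \<or> q"
  obtains R where "R \<in> strict_rankings X"
    "(x, y) \<in> R \<longleftrightarrow> p" "(y, z) \<in> R \<longleftrightarrow> q" "(x, z) \<in> R \<longleftrightarrow> r"
    "\<And>w. w \<in> X \<Longrightarrow> w \<notin> {x, y, z} \<Longrightarrow> (x, w) \<in> R"
proof -
  obtain g :: "'a \<Rightarrow> nat" where g: "inj_on g X"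
    using finite_imp_inj_to_nat_seg[OF \<open>finite X\<close>] by blast
  \<comment> \<open>On \<open>x\<close>, \<open>y\<close>, \<open>z\<close> this counts those of the
    three prescribed to be above \<open>w\<close>; without a cycle the counts are 0, 1, 2 in some
    order. The shift by 3 puts all other alternatives below.\<close>
  define h where "h w =
    (if w = x then (if p then 0 else 1) + (if r then 0 else 1)
     else if w = y then (if p then 1 else 0) + (if q then 0 else 1)
     else if w = z then (if r then 1 else 0) + (if q then 1 else 0)
     else g w + 3)" for w
  have "inj_on h X"
    using g assms(5-9) by (cases p; cases q; cases r) (auto simp: inj_on_def h_def)
  moreover have "h x \<le> h y \<longleftrightarrow> p" "h y \<le> h z \<longleftrightarrow> q" "h x \<le> h z \<longleftrightarrow> r"
    using assms(5-9) by (cases p; cases q; cases r; simp add: h_def)+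
  moreover have "h x \<le> h w" if "w \<notin> {x, y, z}" for w
    using that by (simp add: h_def)
  ultimately show thesis
    using assms(2-4) by (intro that[OF strict_rankings_of_rank]) auto
qed

section \<open>Profiles and coalitions of supporters\<close>

lemma profiles_component:
  "R \<in> profiles X n \<Longrightarrow> i \<in> {1..n} \<Longrightarrow> R i \<in> strict_rankings X"
  by (auto simp: profiles_def)

definition supporters :: "nat \<Rightarrow> (nat \<Rightarrow> 'a rel) \<Rightarrow> 'a \<Rightarrow> 'a \<Rightarrow> nat set" where
  "supporters n R x y = {i \<in> {1..n}. (x, y) \<in> R i}"

lemma supporters_swap:
  assumes "R \<in> profiles X n" "x \<in> X" "y \<in> X" "x \<noteq> y"
  shows "supporters n R y x = {1..n} - supporters n R x y"
  using strict_rankings_not_iff[OF profiles_component[OF assms(1)] assms(2-)]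
  by (auto simp: supporters_def)

text \<open>Turns the agreement hypothesis of GIIA into equality of coalitions.\<close>

lemma supporters_eq_iff_Restr:
  assumes "R \<in> profiles X n" "R' \<in> profiles X n" "x \<in> X" "y \<in> X" "x \<noteq> y"
  shows "supporters n R x y = supporters n R' x y \<longleftrightarrow>
    (\<forall>i\<in>{1..n}. Restr (R i) {x, y} = Restr (R' i) {x, y})"
proof -
  have "Restr (R i) {x, y} = Restr (R' i) {x, y} \<longleftrightarrow> ((x, y) \<in> R i \<longleftrightarrow> (x, y) \<in> R' i)"
    if "i \<in> {1..n}" for i
    using Restr_eq_iff assms that profiles_component by metis
  then have "(\<forall>i\<in>{1..n}. Restr (R i) {x, y} = Restr (R' i) {x, y}) \<longleftrightarrow>
    (\<forall>i\<in>{1..n}. (x, y) \<in> R i \<longleftrightarrow> (x, y) \<in> R' i)"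
    by (rule ball_cong[OF refl])
  then show ?thesis unfolding supporters_def by blast
qed

section \<open>The relation \<open>beats\<close> and its transitivity\<close>

locale dominance_giia =
  fixes X :: "'a set" and n :: nat and f :: "(nat \<Rightarrow> 'a rel) \<Rightarrow> 'a set"
  assumes finite_X: "finite X"
    and card_X: "card X \<ge> 3"
    and choice: "choice_function X n (profiles X n) f"
    and WDC: "WDC X n (profiles X n) f"
    and GIIA: "GIIA X n (profiles X n) f"
begin

lemma choice_subset: "R \<in> profiles X n \<Longrightarrow> f R \<subseteq> X"
  and choice_nonempty: "R \<in> profiles X n \<Longrightarrow> f R \<noteq> {}"
  using choice by (auto simp: choice_function_def)

lemma ex_third:
  obtains z where "z \<in> X" "z \<noteq> x" "z \<noteq> y"
proof -
  have "card {x, y} < card X"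
    using card_X card_insert_le_m1[of 2 "{y}" x] by simp
  then have "\<not> X \<subseteq> {x, y}"
    using card_mono[of "{x, y}" X] by auto
  then show thesis using that by auto
qed

definition beats :: "nat set \<Rightarrow> 'a \<Rightarrow> 'a \<Rightarrow> bool" where
  "beats S x y \<longleftrightarrow> (\<forall>R\<in>profiles X n. supporters n R x y = S \<longrightarrow> y \<notin> f R)"

lemma beatsD: "beats (supporters n R x y) x y \<Longrightarrow> R \<in> profiles X n \<Longrightarrow> y \<notin> f R"
  by (simp add: beats_def)

lemma chosen_beats_rejected:
  assumes "R \<in> profiles X n" "x \<in> f R" "y \<notin> f R" "y \<in> X"
  shows "beats (supporters n R x y) x y"
  unfolding beats_def
proof (intro ballI impI)
  fix R' assume R': "R' \<in> profiles X n" "supporters n R' x y = supporters n R x y"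
  have "x \<in> X" "x \<noteq> y" using assms choice_subset by auto
  then show "y \<notin> f R'"
    using GIIA assms R' supporters_eq_iff_Restr[of R X n R' x y] unfolding GIIA_def by metis
qed

lemma beats_all:
  assumes "x \<in> X" "y \<in> X" "x \<noteq> y"
  shows "beats {1..n} x y"
  using WDC assms unfolding WDC_def beats_def supporters_def by blast

text \<open>State by state, the inclusions between \<open>S\<close>, \<open>T\<close> and
  \<open>U\<close> exclude cycles. Each alternative outside the three lies below \<open>x\<close> in
  every state, so WDC rejects it.\<close>

lemma ex_profile_top3:
  assumes xyz: "x \<in> X" "y \<in> X" "z \<in> X" "x \<noteq> y" "y \<noteq> z" "x \<noteq> z"
    and STU: "S \<inter> T \<subseteq> U" "U \<subseteq> S \<union> T" "S \<subseteq> {1..n}" "T \<subseteq> {1..n}"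
  obtains R where "R \<in> profiles X n"
    "supporters n R x y = S" "supporters n R y z = T" "supporters n R x z = U"
    "f R \<subseteq> {x, y, z}"
proof -
  have "\<exists>Q. Q \<in> strict_rankings X \<and> ((x, y) \<in> Q \<longleftrightarrow> i \<in> S) \<and> ((y, z) \<in> Q \<longleftrightarrow> i \<in> T) \<and>
      ((x, z) \<in> Q \<longleftrightarrow> i \<in> U) \<and> (\<forall>w\<in>X - {x, y, z}. (x, w) \<in> Q)" for i
    using ex_strict_ranking_top3[OF finite_X xyz, of "i \<in> S" "i \<in> T" "i \<in> U"] STU
    by (smt (verit) DiffE IntI UnE subset_iff)
  then obtain Q where Q: "\<And>i. Q i \<in> strict_rankings X"
    "\<And>i. (x, y) \<in> Q i \<longleftrightarrow> i \<in> S" "\<And>i. (y, z) \<in> Q i \<longleftrightarrow> i \<in> T" "\<And>i. (x, z) \<in> Q i \<longleftrightarrow> i \<in> U"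
    "\<And>i w. w \<in> X - {x, y, z} \<Longrightarrow> (x, w) \<in> Q i"
    by metis
  define R where "R = restrict Q {1..n}"
  have R: "R \<in> profiles X n" using Q(1) by (auto simp: R_def profiles_def)
  have "f R \<subseteq> {x, y, z}"
  proof
    fix w assume w: "w \<in> f R"
    show "w \<in> {x, y, z}"
    proof (rule ccontr)
      assume "w \<notin> {x, y, z}"
      then have "w \<in> X - {x, y, z}" using w R choice_subset by auto
      moreover from this have "supporters n R x w = {1..n}"
        using Q(5) by (auto simp: supporters_def R_def)
      ultimately show False using beats_all[of x w] beatsD[of R x w] w R xyz by auto
    qed
  qed
  moreover have "U \<subseteq> {1..n}" using STU by blast
  ultimately show thesis
    using R Q(2-4) STU(3,4) by (intro that[of R]) (auto simp: supporters_def R_def)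
qed

text \<open>In a profile realizing \<open>S\<close>, \<open>T\<close>, \<open>U\<close>, both
  \<open>y\<close> and \<open>z\<close> are rejected, so nonemptiness forces \<open>x\<close> to be
  chosen. The freedom in \<open>U\<close> later yields both monotonicity and closure under
  intersection.\<close>

lemma beats_trans:
  assumes xyz: "x \<in> X" "y \<in> X" "z \<in> X" "x \<noteq> y" "y \<noteq> z" "x \<noteq> z"
    and STU: "S \<inter> T \<subseteq> U" "U \<subseteq> S \<union> T" "S \<subseteq> {1..n}" "T \<subseteq> {1..n}"
    and "beats S x y" "beats T y z"
  shows "beats U x z"
proof -
  obtain R where R: "R \<in> profiles X n" "supporters n R x y = S" "supporters n R y z = T"
    "supporters n R x z = U" "f R \<subseteq> {x, y, z}"
    using ex_profile_top3[OF xyz STU] by blast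
  have "y \<notin> f R" "z \<notin> f R" using assms(11,12) R beatsD by auto
  then have "x \<in> f R" using R(5) choice_nonempty[OF R(1)] by auto
  then show ?thesis using chosen_beats_rejected[of R x z] R \<open>z \<notin> f R\<close> xyz by simp
qed

text \<open>Unanimity for \<open>y\<close> over \<open>z\<close> breaks a possible tie of \<open>x\<close> and \<open>y\<close>.\<close>

lemma beats_if_not_beaten:
  assumes xyz: "x \<in> X" "y \<in> X" "z \<in> X" "x \<noteq> y" "y \<noteq> z" "x \<noteq> z"
    and S: "S \<subseteq> {1..n}" "\<not> beats ({1..n} - S) y x"
  shows "beats S x z"
proof -
  obtain R where R: "R \<in> profiles X n" "supporters n R x y = S" "supporters n R y z = {1..n}"
    "supporters n R x z = S" "f R \<subseteq> {x, y, z}"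
    using ex_profile_top3[OF xyz, of S "{1..n}" S] S by blast
  have z: "z \<notin> f R" using beats_all[of y z] R beatsD[of R y z] xyz by simp
  have "x \<in> f R"
  proof (rule ccontr)
    assume x: "x \<notin> f R"
    then have "y \<in> f R" using z R(5) choice_nonempty[OF R(1)] by auto
    then show False
      using chosen_beats_rejected[of R y x] x R S xyz supporters_swap[of R X n x y] by simp
  qed
  then show ?thesis using chosen_beats_rejected[of R x z] R z xyz by simp
qed

section \<open>Neutrality and monotonicity\<close>

text \<open>Unanimity for \<open>z\<close> over \<open>x\<close> is put in front:
  \<open>{1..n}\<close> and \<open>S\<close> have intersection \<open>S\<close> and union
  \<open>{1..n}\<close>, and \<open>beats_trans\<close> allows every \<open>U\<close> in
  between.\<close>

lemma beats_mono_left: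
  assumes "beats S x y" "x \<in> X" "y \<in> X" "z \<in> X" "x \<noteq> y" "z \<noteq> y" "z \<noteq> x"
    and "S \<subseteq> U" "U \<subseteq> {1..n}"
  shows "beats U z y"
  using assms beats_all[of z x] beats_trans[of z x y "{1..n}" S U] by auto

lemma beats_mono_right:
  assumes "beats S x y" "x \<in> X" "y \<in> X" "z \<in> X" "x \<noteq> y" "x \<noteq> z" "z \<noteq> y"
    and "S \<subseteq> U" "U \<subseteq> {1..n}"
  shows "beats U x z"
  using assms beats_all[of y z] beats_trans[of x y z S "{1..n}" U] by auto

text \<open>Field expansion as in Arrow's theorem: replacing one member of the pair at a time
  reaches every other pair.\<close>

lemma beats_neutral_mono:
  assumes "beats S x y" "x \<in> X" "y \<in> X" "x \<noteq> y" "a \<in> X" "b \<in> X" "a \<noteq> b"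
    and SU: "S \<subseteq> U" "U \<subseteq> {1..n}"
  shows "beats U a b"
proof -
  have sub: "S \<subseteq> {1..n}" using SU by simp
  have left: "beats S c b'" if "beats S a' b'" "a' \<in> X" "b' \<in> X" "c \<in> X" "a' \<noteq> b'" "c \<noteq> b'"
    for a' b' c using beats_mono_left[OF that _ order_refl sub] that(1) by (cases "c = a'") auto
  have right: "beats S a' c" if "beats S a' b'" "a' \<in> X" "b' \<in> X" "c \<in> X" "a' \<noteq> b'" "a' \<noteq> c"
    for a' b' c using beats_mono_right[OF that _ order_refl sub] that(1) by (cases "c = b'") auto
  have any: "beats S c d" if "c \<in> X" "d \<in> X" "c \<noteq> d" for c d
  proof -
    obtain z where z: "z \<in> X" "z \<noteq> x" "z \<noteq> d" using ex_third .
    have "beats S x z" using right[OF assms(1)] z assms by auto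
    show ?thesis
    proof (cases "c = z")
      case True
      \<comment> \<open>Passing through \<open>(c, z)\<close> would be degenerate here, so the route
        is \<open>(x, z)\<close>, \<open>(w, z)\<close>, \<open>(w, d)\<close>,
        \<open>(c, d)\<close>.\<close>
      obtain w where w: "w \<in> X" "w \<noteq> z" "w \<noteq> d" using ex_third .
      have "beats S w z" using left[OF \<open>beats S x z\<close>] z w assms by auto
      then have "beats S w d" using right z w that by metis
      then show ?thesis using left z w that by metis
    next
      case False
      then have "beats S c z" using left[OF \<open>beats S x z\<close>] z that assms by auto
      then show ?thesis using right z that False by metis
    qed
  qed
  \<comment> \<open>All replacements so far kept \<open>S\<close>; the last one, of \<open>z\<close>
    by \<open>b\<close>, enlarges it to \<open>U\<close>.\<close>
  obtain z where z: "z \<in> X" "z \<noteq> a" "z \<noteq> b" using ex_third .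
  show ?thesis using beats_mono_right[OF any[of a z]] z assms sub by auto
qed

section \<open>The ultrafilter of winning coalitions\<close>

definition winning :: "nat set \<Rightarrow> bool" where
  "winning S \<longleftrightarrow> (\<forall>x\<in>X. \<forall>y\<in>X. x \<noteq> y \<longrightarrow> beats S x y)"

lemma winning_mono: "winning S \<Longrightarrow> S \<subseteq> U \<Longrightarrow> U \<subseteq> {1..n} \<Longrightarrow> winning U"
  unfolding winning_def using beats_neutral_mono by metis

text \<open>Through a third alternative \<open>z\<close>, \<open>S\<close> decides \<open>x\<close>
  over \<open>z\<close> and \<open>T\<close> decides \<open>z\<close> over \<open>y\<close>;
  \<open>beats_trans\<close> permits the intersection as the resulting coalition.\<close>

lemma winning_Int:
  assumes "winning S" "winning T" "S \<subseteq> {1..n}" "T \<subseteq> {1..n}"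
  shows "winning (S \<inter> T)"
  unfolding winning_def
proof (intro ballI impI)
  fix x y assume xy: "x \<in> X" "y \<in> X" "x \<noteq> y"
  obtain z where "z \<in> X" "z \<noteq> x" "z \<noteq> y" using ex_third .
  then show "beats (S \<inter> T) x y"
    using beats_trans[of x z y S T "S \<inter> T"] assms xy unfolding winning_def by auto
qed

text \<open>One pair on which the complement fails gives one pair on which \<open>S\<close>
  succeeds, and neutrality spreads this to all pairs.\<close>

lemma winning_Compl:
  assumes "S \<subseteq> {1..n}" "\<not> winning ({1..n} - S)"
  shows "winning S"
proof -
  obtain x y where xy: "x \<in> X" "y \<in> X" "x \<noteq> y" "\<not> beats ({1..n} - S) y x"
    using assms(2) unfolding winning_def by metis
  obtain z where z: "z \<in> X" "z \<noteq> x" "z \<noteq> y" using ex_third .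
  then have "beats S x z" using beats_if_not_beaten[of x y z S] xy assms by auto
  then show ?thesis
    unfolding winning_def using beats_neutral_mono[of S x z] xy z assms(1) by auto
qed

text \<open>Otherwise, by monotonicity, every coalition would win, and even a chosen alternative
  would be rejected.\<close>

lemma not_winning_empty: "\<not> winning {}"
proof
  assume "winning {}"
  obtain R where R: "R \<in> profiles X n" using choice by (auto simp: choice_function_def)
  obtain b where b: "b \<in> f R" using choice_nonempty[OF R] by auto
  then have "b \<in> X" using choice_subset[OF R] by auto
  obtain a where a: "a \<in> X" "a \<noteq> b" using ex_third .
  have "winning (supporters n R a b)"
    by (rule winning_mono[OF \<open>winning {}\<close>]) (auto simp: supporters_def)
  then show False using a b \<open>b \<in> X\<close> R beatsD unfolding winning_def by metis
qed

lemma winning_all: "winning {1..n}"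
  unfolding winning_def using beats_all by blast

text \<open>Take a winning \<open>S\<close> of least size and \<open>i\<close> in it. If
  \<open>{i}\<close> lost, its complement would win, and intersecting with \<open>S\<close> would
  give the smaller winning coalition \<open>S - {i}\<close>.\<close>

lemma ex_winning_singleton:
  obtains i where "i \<in> {1..n}" "winning {i}"
proof -
  obtain S where S: "S \<subseteq> {1..n}" "winning S"
    and min: "\<And>T. T \<subseteq> {1..n} \<Longrightarrow> winning T \<Longrightarrow> card S \<le> card T"
    using ex_has_least_nat[of "\<lambda>S. S \<subseteq> {1..n} \<and> winning S" "{1..n}" card] winning_all by blast
  then obtain i where i: "i \<in> S" using not_winning_empty by (cases "S = {}") auto
  have "winning {i}"
  proof (rule ccontr)
    assume "\<not> winning {i}"
    then have "winning ({1..n} - {i})"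
      using winning_Compl[of "{1..n} - {i}"] S i by (auto simp: double_diff)
    then have "winning (S \<inter> ({1..n} - {i}))" using winning_Int S by blast
    moreover have "S \<inter> ({1..n} - {i}) = S - {i}" using S by auto
    ultimately have "card S \<le> card (S - {i})" using min[of "S - {i}"] S by auto
    moreover have "finite S" using S finite_subset by blast
    ultimately show False using card_Diff1_less[of S i] i by simp
  qed
  then show thesis using that S i by blast
qed

lemma state_salient: "state_salient_decision_rule X n f"
proof -
  obtain i where i: "i \<in> {1..n}" "winning {i}" using ex_winning_singleton .
  have "y \<notin> f R" if "x \<in> X" "y \<in> X" "R \<in> profiles X n" "x \<noteq> y" "(x, y) \<in> R i" for x y R
  proof -
    have "winning (supporters n R x y)"
      using i that by (intro winning_mono[OF i(2)]) (auto simp: supporters_def)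
    then show ?thesis using that beatsD unfolding winning_def by metis
  qed
  then show ?thesis using i unfolding state_salient_decision_rule_def by blast
qed

end

section \<open>The converse direction\<close>

lemma WDC_if_state_salient:
  "state_salient_decision_rule X n f \<Longrightarrow> WDC X n (profiles X n) f"
  unfolding state_salient_decision_rule_def WDC_def by blast

text \<open>A chosen \<open>x\<close> cannot lie below \<open>y\<close> in the salient state;
  agreement on the pair carries \<open>x\<close> above \<open>y\<close> over to the second profile,
  where salience rejects \<open>y\<close>.\<close>

lemma GIIA_if_state_salient:
  assumes "state_salient_decision_rule X n f"
  shows "GIIA X n (profiles X n) f"
proof -
  obtain i where i: "i \<in> {1..n}"
    and sal: "\<And>x y R. x \<in> X \<Longrightarrow> y \<in> X \<Longrightarrow> R \<in> profiles X n \<Longrightarrow> x \<noteq> y \<Longrightarrow> (x, y) \<in> R i \<Longrightarrow> y \<notin> f R"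
    using assms unfolding state_salient_decision_rule_def by metis
  show ?thesis
    unfolding GIIA_def
  proof (intro ballI impI)
    fix R R' x y
    assume R: "R \<in> profiles X n" "R' \<in> profiles X n" and xy: "x \<in> X" "y \<in> X" "x \<noteq> y"
      and eq: "\<forall>i\<in>{1..n}. Restr (R i) {x, y} = Restr (R' i) {x, y}"
      and f: "x \<in> f R"
    have "(y, x) \<notin> R i" using sal[of y x R] R xy f by auto
    then have "(x, y) \<in> R i"
      using strict_rankings_not_iff profiles_component[OF R(1) i] xy by metis
    then have "(x, y) \<in> R' i" using eq i by auto
    then show "y \<notin> f R'" using sal R xy by metis
  qed
qed

theorem theorem1:
  fixes X :: "'a set" and n :: nat and f :: "(nat \<Rightarrow> 'a rel) \<Rightarrow> 'a set"
  assumes "finite X" and "card X \<ge> 3" and "n \<ge> 2"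
    and "choice_function X n (profiles X n) f"
  shows "WDC X n (profiles X n) f \<and> GIIA X n (profiles X n) f
    \<longleftrightarrow> state_salient_decision_rule X n f"
proof
  assume "WDC X n (profiles X n) f \<and> GIIA X n (profiles X n) f"
  then interpret dominance_giia X n f using assms by unfold_locales auto
  show "state_salient_decision_rule X n f" by (rule state_salient)
next
  assume "state_salient_decision_rule X n f"
  then show "WDC X n (profiles X n) f \<and> GIIA X n (profiles X n) f"
    using WDC_if_state_salient GIIA_if_state_salient by blast
qed

end
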